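(* Let $p$ be a prime with $p\equiv 1\pmod 3$, let $d\in\mathbb{F}_p^*$ be a square, let $d'=-27d$, and let $\tau_d\colon E_d\to E_{d'}$ be the $3$-isogeny with attached character $\chi_{\tau_d}$ (defined in the context). Then $$S_{\tau_d}:=\sum_{P\in E_{d'}(\mathbb{F}_p)\setminus\{\infty\}}\{x(P)\}\,\chi_{\tau_d}(P)$$ is an integer divisible by $p$.
   Context: For $a\in\mathbb{F}_p$, $\{a\}$ denotes the unique integer with $0\le\{a\}\le p-1$ whose residue class mod $p$ is $a$; $x(P)$ is the $x$-coordinate of $P$. $\zeta$ is a fixed primitive complex cube root of unity. For $d\in\mathbb{F}_p^*$ let $E_d$ be the elliptic curve $y^2=x^3+d$ over $\mathbb{F}_p$. The map $$\tau_d(x,y)=\left(\frac{y^2+3d}{x^2},\ \frac{y(x^3-8d)}{x^3}\right)$$ defines a $3$-isogeny $\tau_d\colon E_d\to E_{d'}$ over $\mathbb{F}_p$, where $d'=-27d$. Here $E(\mathbb{F}_p)$ is the full group of rational points including $\infty$. When $d$ is a nonzero square and $p\equiv 1\pmod 3$ one has $E_{d'}(\mathbb{F}_p)/\tau_d(E_d(\mathbb{F}_p))\cong\mathbb{Z}/3\mathbb{Z}$. Choose any $Q\in E_{d'}(\mathbb{F}_p)\setminus\tau_d(E_d(\mathbb{F}_p))$. For $P\in E_{d'}(\mathbb{F}_p)$ define $\chi_{\tau_d}(P)=\zeta^k$, where $k\in\{0,1,2\}$ is the unique value with $P-kQ\in\tau_d(E_d(\mathbb{F}_p))$. *)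

theory Defs
  imports Complex_Main "Berlekamp_Zassenhaus.Finite_Field"
begin

datatype 'a point = Infinity | Point (xcoord: 'a) (ycoord: 'a)

definition curve :: "'a::field \<Rightarrow> 'a point set" where
  "curve d = insert Infinity {Point x y | x y. y ^ 2 = x ^ 3 + d}"

text \<open>The chord-tangent group law on \<open>y\<^sup>2 = x\<^sup>3 + d\<close>. It does not mention \<open>d\<close>: the tangent slope
  at \<open>(x, y)\<close> is \<open>3 x\<^sup>2 / (2 y)\<close> for every \<open>d\<close>. On the curve, in characteristic different from 2,
  the tangent case is reached only when both points coincide and \<open>y\<close> is nonzero.\<close>

fun pneg :: "'a::field point \<Rightarrow> 'a point" where
  "pneg Infinity = Infinity"
| "pneg (Point x y) = Point x (- y)"

fun padd :: "'a::field point \<Rightarrow> 'a point \<Rightarrow> 'a point" where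
  "padd Infinity Q = Q"
| "padd (Point x1 y1) Infinity = Point x1 y1"
| "padd (Point x1 y1) (Point x2 y2) =
    (if x1 = x2 \<and> y1 = - y2 then Infinity
     else let l = (if x1 = x2 then 3 * x1 ^ 2 / (2 * y1) else (y2 - y1) / (x2 - x1));
              x3 = l ^ 2 - x1 - x2
          in Point x3 (l * (x1 - x3) - y1))"

primrec pmult :: "nat \<Rightarrow> 'a::field point \<Rightarrow> 'a point" where
  "pmult 0 P = Infinity"
| "pmult (Suc k) P = padd P (pmult k P)"

text \<open>The isogeny from \<open>curve d\<close> to \<open>curve (-27 * d)\<close>; the affine points with \<open>x = 0\<close>, where the
  rational formula has poles, belong to its kernel.\<close>

fun isog :: "'a::field \<Rightarrow> 'a point \<Rightarrow> 'a point" where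
  "isog d Infinity = Infinity"
| "isog d (Point x y) =
    (if x = 0 then Infinity
     else Point ((y ^ 2 + 3 * d) / x ^ 2) (y * (x ^ 3 - 8 * d) / x ^ 3))"

definition isog_char :: "'a::field \<Rightarrow> 'a point \<Rightarrow> complex \<Rightarrow> 'a point \<Rightarrow> complex" where
  "isog_char d Q \<zeta> P =
    \<zeta> ^ (THE k. k \<in> {0, 1, 2} \<and> padd P (pneg (pmult k Q)) \<in> isog d ` curve d)"

definition primitive_root_of_unity :: "nat \<Rightarrow> complex \<Rightarrow> bool" where
  "primitive_root_of_unity n z \<longleftrightarrow> z ^ n = 1 \<and> (\<forall>m. 0 < m \<and> m < n \<longrightarrow> z ^ m \<noteq> 1)"

end

theory Submission
  imports Defs "HOL-Computational_Algebra.Polynomial"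
begin

text \<open>Write \<open>d = c\<^sup>2\<close> and \<open>d' = b\<^sup>2\<close> with \<open>b = 3 s c\<close>, \<open>s\<^sup>2 = -3\<close>. The map \<open>(x, y) \<mapsto> y - b\<close> induces a
  homomorphism from the points of \<open>y\<^sup>2 = x\<^sup>3 + d'\<close> to the units modulo cubes whose kernel is the image
  of the isogeny, so the character depends only on \<open>y\<close>. For a cube root of unity \<open>w \<noteq> 1\<close> of the prime
  field, \<open>(x, y) \<mapsto> (w x, y)\<close> therefore permutes every class, and the sum of \<open>x\<close> over a class is
  multiplied by \<open>w\<close>, hence zero modulo \<open>p\<close>. Negation exchanges the two nontrivial classes and fixes
  \<open>x\<close>, so the character sum is the difference of two integral class sums.\<close>

section \<open>Chords and tangents\<close>

lemma finite_point_set: "finite (S :: 'a::finite point set)"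
proof (rule finite_subset)
  show "S \<subseteq> insert Infinity (case_prod Point ` UNIV)"
  proof
    fix P show "P \<in> insert Infinity (case_prod Point ` UNIV)"
      by (cases P) force+
  qed
qed simp

lemma pneg_pneg [simp]: "pneg (pneg P) = P"
  by (cases P) auto

lemma pneg_eq_Infinity_iff [simp]: "pneg P = Infinity \<longleftrightarrow> P = Infinity"
  by (cases P) auto

lemma xcoord_pneg: "P \<noteq> Infinity \<Longrightarrow> xcoord (pneg P) = xcoord P"
  by (cases P) auto

lemma pneg_in_curve [simp]: "pneg P \<in> curve d \<longleftrightarrow> P \<in> curve d"
  by (cases P) (auto simp: curve_def)

lemma Infinity_in_curve [simp]: "Infinity \<in> curve d"
  by (simp add: curve_def)

lemma Point_in_curve [simp]: "Point x y \<in> curve d \<longleftrightarrow> y ^ 2 = x ^ 3 + d"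
  by (simp add: curve_def)

lemma padd_Infinity_right [simp]: "padd P Infinity = P"
  by (cases P) auto

text \<open>The last three equations are Vieta's formulas for the cubic
  \<open>X\<^sup>3 + d - (l X + m)\<^sup>2\<close>, whose roots are the abscissae of the points on the line
  \<open>y = l x + m\<close>.\<close>

lemma padd_line:
  fixes x1 y1 x2 y2 :: "'a::field"
  assumes two: "(2::'a) \<noteq> 0"
    and P: "Point x1 y1 \<in> curve d" and R: "Point x2 y2 \<in> curve d"
    and nopp: "\<not> (x1 = x2 \<and> y1 = - y2)"
  obtains l m x3 where "padd (Point x1 y1) (Point x2 y2) = Point x3 (- (l * x3 + m))"
    "y1 = l * x1 + m" "y2 = l * x2 + m"
    "x1 + x2 + x3 = l ^ 2"
    "x1 * x2 + x1 * x3 + x2 * x3 = - 2 * l * m"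
    "x1 * x2 * x3 = m ^ 2 - d"
proof -
  define l where "l = (if x1 = x2 then 3 * x1 ^ 2 / (2 * y1) else (y2 - y1) / (x2 - x1))"
  define m where "m = y1 - l * x1"
  define x3 where "x3 = l ^ 2 - x1 - x2"
  have e1: "y1 ^ 2 = x1 ^ 3 + d" and e2: "y2 ^ 2 = x2 ^ 3 + d"
    using P R by simp_all
  have y1: "y1 = l * x1 + m" by (simp add: m_def)
  \<comment> \<open>The second conjunct is \<open>y1 ^ 2 - y2 ^ 2 = x1 ^ 3 - x2 ^ 3\<close> with the
    factor \<open>x1 - x2\<close> cancelled. In the tangent case it survives as the defining
    equation of the slope, so both cases lead to the same Vieta formulas.\<close>
  have "y2 = l * x2 + m \<and> l * (y1 + y2) = x1 ^ 2 + x1 * x2 + x2 ^ 2"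
  proof (cases "x1 = x2")
    case True
    have "(y1 - y2) * (y1 + y2) = 0" using e1 e2 True by Groebner_Basis.algebra
    with nopp True have y: "y1 = y2" by (auto simp: eq_neg_iff_add_eq_0)
    with nopp True have "2 * y1 \<noteq> 0" using two
      by (metis mult_2 eq_neg_iff_add_eq_0)
    then have "l * (2 * y1) = 3 * x1 ^ 2" using True by (simp add: l_def)
    then show ?thesis using y True y1 by Groebner_Basis.algebra
  next
    case False
    then have l: "l * (x2 - x1) = y2 - y1" by (simp add: l_def)
    then have "(x2 - x1) * (l * (y1 + y2)) = (x2 - x1) * (x1 ^ 2 + x1 * x2 + x2 ^ 2)"
      using e1 e2 by Groebner_Basis.algebra
    then have "l * (y1 + y2) = x1 ^ 2 + x1 * x2 + x2 ^ 2" using False by simp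
    then show ?thesis using l y1 by Groebner_Basis.algebra
  qed
  then have y2: "y2 = l * x2 + m" and key: "l * (y1 + y2) = x1 ^ 2 + x1 * x2 + x2 ^ 2"
    by auto
  have v1: "x1 + x2 + x3 = l ^ 2" by (simp add: x3_def)
  have v2: "x1 * x2 + x1 * x3 + x2 * x3 = - 2 * l * m"
    using key y1 y2 v1 by Groebner_Basis.algebra
  have v3: "x1 * x2 * x3 = m ^ 2 - d"
    using v1 v2 e1 y1 by Groebner_Basis.algebra
  have "padd (Point x1 y1) (Point x2 y2) = Point x3 (l * (x1 - x3) - y1)"
    using nopp by (simp add: Let_def l_def x3_def)
  also have "l * (x1 - x3) - y1 = - (l * x3 + m)"
    by (simp add: m_def algebra_simps)
  finally show ?thesis using that y1 y2 v1 v2 v3 by blast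
qed

lemma padd_in_curve:
  fixes d :: "'a::field"
  assumes two: "(2::'a) \<noteq> 0" and "P \<in> curve d" "R \<in> curve d"
  shows "padd P R \<in> curve d"
proof (cases P)
  case P: (Point x1 y1)
  show ?thesis
  proof (cases R)
    case R: (Point x2 y2)
    show ?thesis
    proof (cases "x1 = x2 \<and> y1 = - y2")
      case False
      obtain l m x3 where
        *: "padd (Point x1 y1) (Point x2 y2) = Point x3 (- (l * x3 + m))"
        "x1 + x2 + x3 = l ^ 2" "x1 * x2 + x1 * x3 + x2 * x3 = - 2 * l * m"
        "x1 * x2 * x3 = m ^ 2 - d"
        using padd_line[OF two, of x1 y1 d x2 y2] False assms(2,3) unfolding P R by metis
      \<comment> \<open>By the Vieta relations \<open>x3\<close> is a root of
        \<open>X^3 + d - (l X + m)^2\<close>.\<close>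
      have "(- (l * x3 + m)) ^ 2 = x3 ^ 3 + d"
        using *(2-4) by Groebner_Basis.algebra
      then show ?thesis unfolding P R *(1) by simp
    qed (simp add: P R)
  qed (use assms P in simp)
qed (use assms in simp)

lemma pmult_in_curve:
  fixes d :: "'a::field"
  assumes "(2::'a) \<noteq> 0" and "P \<in> curve d"
  shows "pmult k P \<in> curve d"
  using assms by (induction k) (auto intro: padd_in_curve)


section \<open>The cubic residue symbol of a finite field\<close>

definition cubic_symbol :: "'a::finite_field \<Rightarrow> 'a" where
  "cubic_symbol a = a ^ ((CARD('a) - 1) div 3)"

lemma cubic_symbol_mult: "cubic_symbol (a * b) = cubic_symbol a * cubic_symbol b"
  by (simp add: cubic_symbol_def power_mult_distrib)

lemma cubic_symbol_power: "cubic_symbol (a ^ n) = cubic_symbol a ^ n"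
  by (simp add: cubic_symbol_def power_mult[symmetric] mult.commute)

lemma card_ge_4:
  assumes "CARD('a) mod 3 = 1"
  shows "CARD('a::finite_field) \<ge> 4"
proof -
  have "card {0::'a, 1} \<le> CARD('a)" by (intro card_mono) auto
  then have "CARD('a) \<ge> 2" by simp
  then show ?thesis using assms by presburger
qed

lemma cubic_symbol_pow3:
  fixes a :: "'a::finite_field"
  assumes "CARD('a) mod 3 = 1" and "a \<noteq> 0"
  shows "cubic_symbol a ^ 3 = 1"
proof -
  have n: "(CARD('a) - 1) div 3 * 3 = CARD('a) - 1" using assms(1) by presburger
  have "a * a ^ (CARD('a) - 1) = a * 1"
    using finite_field_power_card_eq_same[of a] finite_UNIV_card_ge_0[where 'a='a]
    by (metis mult.right_neutral power_eq_if finite not_gr_zero)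
  then have "a ^ (CARD('a) - 1) = 1" using assms(2) by simp
  then show ?thesis
    unfolding cubic_symbol_def power_mult[symmetric] n .
qed

lemma cubic_symbol_cube:
  fixes a :: "'a::finite_field"
  assumes "CARD('a) mod 3 = 1" and "a \<noteq> 0"
  shows "cubic_symbol (a ^ 3) = 1"
  using cubic_symbol_pow3[OF assms] by (simp add: cubic_symbol_power)

lemma card_cubic_symbol_eq_1:
  assumes "CARD('a) mod 3 = 1"
  shows "card {a::'a::finite_field. cubic_symbol a = 1} \<le> (CARD('a) - 1) div 3"
proof -
  define n where "n = (CARD('a) - 1) div 3"
  have n: "n > 0" using card_ge_4[OF assms] by (simp add: n_def)
  define f :: "'a poly" where "f = monom 1 n - 1"
  have "coeff f n = 1" using n by (simp add: f_def)
  then have f0: "f \<noteq> 0" by auto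
  have "degree f \<le> n"
    unfolding f_def by (intro degree_diff_le) (auto intro: degree_monom_le)
  moreover have "{a::'a. cubic_symbol a = 1} = {a. poly f a = 0}"
    by (simp add: f_def cubic_symbol_def n_def poly_monom)
  ultimately show ?thesis
    using card_poly_roots_bound[OF f0] unfolding n_def by simp
qed

text \<open>The root is the symbol of a suitable unit: \<open>X^((q-1)/3) - 1\<close> has too few
  roots for all \<open>q - 1\<close> units to have symbol 1.\<close>

lemma primitive_cube_root_exists:
  assumes "CARD('a) mod 3 = 1"
  obtains w :: "'a::finite_field" where "w ^ 2 + w + 1 = 0" "w \<noteq> 1"
proof -
  have "\<exists>a::'a. a \<noteq> 0 \<and> cubic_symbol a \<noteq> 1"
  proof (rule ccontr)
    assume "\<not> ?thesis"
    then have "UNIV - {0::'a} \<subseteq> {a. cubic_symbol a = 1}" by auto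
    then have "card (UNIV - {0::'a}) \<le> card {a::'a. cubic_symbol a = 1}"
      by (intro card_mono) auto
    then have "CARD('a) - 1 \<le> (CARD('a) - 1) div 3"
      using card_cubic_symbol_eq_1[OF assms] by simp
    then show False using card_ge_4[OF assms] by simp
  qed
  then obtain a :: 'a where a: "a \<noteq> 0" "cubic_symbol a \<noteq> 1" by blast
  define w where "w = cubic_symbol a"
  have "(w - 1) * (w ^ 2 + w + 1) = w ^ 3 - 1" by Groebner_Basis.algebra
  also have "\<dots> = 0" using cubic_symbol_pow3[OF assms a(1)] by (simp add: w_def)
  finally show ?thesis using that a(2) by (auto simp: w_def)
qed

text \<open>Together with \<open>g \<noteq> 1\<close> this makes \<open>1\<close>, \<open>g\<close>,
  \<open>g ^ 2\<close> pairwise distinct, which separates the three classes of points.\<close>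

lemma square_neq_if_cube_eq_1:
  fixes g :: "'a::field"
  assumes "g ^ 3 = 1" "g \<noteq> 1"
  shows "g ^ 2 \<noteq> 1" "g ^ 2 \<noteq> g"
proof -
  have "g * g ^ 2 = 1" using assms(1) by (simp flip: power_Suc add: numeral_3_eq_3)
  then show "g ^ 2 \<noteq> 1" "g ^ 2 \<noteq> g"
    using assms(2) by (metis mult.right_neutral, metis power2_eq_square mult.right_neutral)
qed

text \<open>For a cube root of unity, \<open>y ^ 2\<close> is the inverse of \<open>y\<close>.
  Inverses of descent values appear below as squares.\<close>

lemma mult_square_eq_1_iff:
  fixes x y :: "'a::field"
  assumes "y ^ 3 = 1"
  shows "x * y ^ 2 = 1 \<longleftrightarrow> x = y"
proof
  assume "x * y ^ 2 = 1"
  moreover have "(x * y ^ 2) * y = x" using assms by Groebner_Basis.algebra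
  ultimately show "x = y" by simp
next
  have "y * y ^ 2 = y ^ 3" by Groebner_Basis.algebra
  moreover assume "x = y"
  ultimately show "x * y ^ 2 = 1" using assms by simp
qed

lemma cube_eq_cube_cases:
  fixes w :: "'a::field"
  assumes "w ^ 2 + w + 1 = 0" "x ^ 3 = y ^ 3"
  shows "x = y \<or> x = w * y \<or> x = w ^ 2 * y"
proof -
  have "(x - y) * ((x - w * y) * (x - w ^ 2 * y)) = 0" using assms by Groebner_Basis.algebra
  then show ?thesis by auto
qed

text \<open>The cubing map on the units has fibres of at most three elements, so there are at least
  \<open>(q - 1) / 3\<close> nonzero cubes; they exhaust the roots of \<open>X\<^bsup>(q - 1) / 3\<^esup> - 1\<close>.\<close>

lemma cubic_symbol_eq_1_iff:
  fixes a :: "'a::finite_field"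
  assumes card: "CARD('a) mod 3 = 1" and a: "a \<noteq> 0"
  shows "cubic_symbol a = 1 \<longleftrightarrow> (\<exists>t. a = t ^ 3)"
proof
  assume "\<exists>t. a = t ^ 3"
  then show "cubic_symbol a = 1" using a cubic_symbol_cube[OF card] by force
next
  obtain w :: 'a where w: "w ^ 2 + w + 1 = 0"
    using primitive_cube_root_exists[OF card] by blast
  define C where "C = (\<lambda>t::'a. t ^ 3) ` (UNIV - {0})"
  have fib: "card ((\<lambda>t. t ^ 3) -` {c} \<inter> (UNIV - {0})) \<le> 3" for c :: 'a
  proof (cases "\<exists>t. c = t ^ 3")
    case True
    then obtain t where t: "c = t ^ 3" by blast
    have "(\<lambda>t. t ^ 3) -` {c} \<inter> (UNIV - {0}) \<subseteq> set [t, w * t, w ^ 2 * t]"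
      using cube_eq_cube_cases[OF w] t by auto
    then have "card ((\<lambda>t. t ^ 3) -` {c} \<inter> (UNIV - {0})) \<le> card (set [t, w * t, w ^ 2 * t])"
      by (intro card_mono) auto
    also have "\<dots> \<le> length [t, w * t, w ^ 2 * t]" by (rule card_length)
    finally show ?thesis by simp
  next
    case False
    then have "(\<lambda>t. t ^ 3) -` {c} \<inter> (UNIV - {0}) = {}" by auto
    then show ?thesis by (metis card.empty zero_le)
  qed
  have "UNIV - {0} = (\<Union>c\<in>C. (\<lambda>t. t ^ 3) -` {c} \<inter> (UNIV - {0::'a}))"
    by (auto simp: C_def)
  then have "card (UNIV - {0::'a}) \<le> (\<Sum>c\<in>C. card ((\<lambda>t. t ^ 3) -` {c} \<inter> (UNIV - {0::'a})))"
    using card_UN_le[of C "\<lambda>c. (\<lambda>t. t ^ 3) -` {c} \<inter> (UNIV - {0::'a})"] by simp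
  also have "\<dots> \<le> (\<Sum>c\<in>C. 3)" by (intro sum_mono fib)
  finally have "CARD('a) - 1 \<le> card C * 3" by simp
  then have "(CARD('a) - 1) div 3 \<le> card C" by simp
  then have "card {a::'a. cubic_symbol a = 1} \<le> card C"
    using card_cubic_symbol_eq_1[OF card] by simp
  moreover have "C \<subseteq> {a. cubic_symbol a = 1}"
    using cubic_symbol_cube[OF card] by (auto simp: C_def)
  ultimately have "C = {a. cubic_symbol a = 1}" by (intro card_seteq) auto
  then show "cubic_symbol a = 1 \<Longrightarrow> \<exists>t. a = t ^ 3"
    by (auto simp: C_def)
qed


section \<open>The descent homomorphism\<close>

text \<open>At \<open>(0, b)\<close>, where \<open>y - b\<close> vanishes, its class modulo cubes is read off from
  \<open>(y - b) (y + b) = x\<^sup>3\<close> as that of \<open>(y + b)\<^sup>-\<^sup>1\<close>, hence of \<open>(y + b)\<^sup>2\<close>.\<close>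

fun descent :: "'a::finite_field \<Rightarrow> 'a point \<Rightarrow> 'a" where
  "descent b Infinity = 1"
| "descent b (Point x y) = (if y = b then cubic_symbol (2 * b) ^ 2 else cubic_symbol (y - b))"

locale three_descent =
  fixes b :: "'a::finite_field"
  assumes card: "CARD('a) mod 3 = 1"
    and two: "(2::'a) \<noteq> 0"
    and b: "b \<noteq> 0"
begin

text \<open>Since \<open>(y - b) * (y + b) = x ^ 3\<close> is a cube, the symbols of the two factors
  are mutually inverse. This form also covers \<open>y = b\<close> and fails only at
  \<open>y = - b\<close>.\<close>

lemma descent_plus:
  assumes P: "Point x y \<in> curve (b ^ 2)" and y: "y \<noteq> - b"
  shows "descent b (Point x y) = cubic_symbol (y + b) ^ 2"
proof (cases "y = b")
  case False
  have yb: "y + b \<noteq> 0" using y by (simp add: add_eq_0_iff2)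
  have prod: "(y - b) * (y + b) = x ^ 3" using P by (simp, Groebner_Basis.algebra)
  then have "x \<noteq> 0" using False yb by auto
  then have "cubic_symbol (y - b) * cubic_symbol (y + b) = 1"
    using prod cubic_symbol_cube[OF card] by (metis cubic_symbol_mult)
  moreover have "cubic_symbol (y + b) ^ 3 = 1" using yb by (rule cubic_symbol_pow3[OF card])
  ultimately have "cubic_symbol (y - b) = cubic_symbol (y + b) ^ 2" by Groebner_Basis.algebra
  then show ?thesis using False by simp
qed (simp flip: mult_2)

lemma descent_pow3: "descent b P ^ 3 = 1"
proof (cases P)
  case (Point x y)
  have "cubic_symbol (2 * b) ^ 3 = 1" using two b by (intro cubic_symbol_pow3[OF card]) simp
  then have "(cubic_symbol (2 * b) ^ 2) ^ 3 = 1" by Groebner_Basis.algebra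
  then show ?thesis using cubic_symbol_pow3[OF card, of "y - b"] Point by auto
qed simp

lemma neg_b_neq: "- b \<noteq> b"
proof
  assume "- b = b"
  then have "2 * b = 0" by (metis mult_2 add.left_inverse)
  then show False using two b by simp
qed

text \<open>\<open>-1\<close> is the cube of itself.\<close>

lemma cubic_symbol_minus: "cubic_symbol (- a) = cubic_symbol (a::'a)"
proof -
  have "cubic_symbol ((-1) ^ 3 * a) = cubic_symbol a"
    using cubic_symbol_cube[OF card, of "-1"] by (metis cubic_symbol_mult mult_1 neg_equal_0_iff_equal zero_neq_one)
  then show ?thesis by simp
qed

text \<open>Negation turns \<open>y - b\<close> into \<open>-(y + b)\<close>, whose symbol is
  inverse to that of \<open>y - b\<close>.\<close>

lemma descent_pneg:
  assumes "P \<in> curve (b ^ 2)"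
  shows "descent b (pneg P) = descent b P ^ 2"
proof (cases P)
  case P: (Point x y)
  show ?thesis
  proof (cases "y = - b")
    case True
    have "cubic_symbol (- b - b) = cubic_symbol (2 * b)"
      using cubic_symbol_minus[of "2 * b"] by (simp add: algebra_simps)
    then show ?thesis using True P neg_b_neq by simp
  next
    case False
    have "descent b P = cubic_symbol (y + b) ^ 2"
      using descent_plus[OF _ False] assms P by simp
    moreover have "- y \<noteq> b" using False by auto
    then have "descent b (pneg P) = cubic_symbol (- (y + b))" using P by simp
    then have "descent b (pneg P) = cubic_symbol (y + b)" by (simp only: cubic_symbol_minus)
    moreover have "cubic_symbol (y + b) ^ 3 = 1"
      using False by (intro cubic_symbol_pow3[OF card]) (simp add: add_eq_0_iff2)
    ultimately show ?thesis by (simp, Groebner_Basis.algebra)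
  qed
qed simp

text \<open>Substituting the root \<open>(b - m) / l\<close> of \<open>l X + m - b\<close> into the cubic whose roots are the three
  abscissae gives \<open>(m - b)\<^sup>3\<close> for the product of the values of \<open>y - b\<close>, and
  likewise \<open>(m + b)\<^sup>3\<close> for \<open>y + b\<close>. One of \<open>m - b\<close>, \<open>m + b\<close> is nonzero.\<close>

lemma descent_collinear:
  fixes x1 x2 x3 l m :: 'a
  assumes P: "Point x1 (l * x1 + m) \<in> curve (b ^ 2)" "Point x2 (l * x2 + m) \<in> curve (b ^ 2)"
      "Point x3 (l * x3 + m) \<in> curve (b ^ 2)"
    and v: "x1 + x2 + x3 = l ^ 2" "x1 * x2 + x1 * x3 + x2 * x3 = - 2 * l * m"
      "x1 * x2 * x3 = m ^ 2 - b ^ 2"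
  shows "descent b (Point x1 (l * x1 + m)) * descent b (Point x2 (l * x2 + m)) *
    descent b (Point x3 (l * x3 + m)) = 1"
proof (cases "m = b")
  case False
  have prod: "(l * x1 + m - b) * (l * x2 + m - b) * (l * x3 + m - b) = (m - b) ^ 3"
    using v by Groebner_Basis.algebra
  then have "l * x1 + m - b \<noteq> 0 \<and> l * x2 + m - b \<noteq> 0 \<and> l * x3 + m - b \<noteq> 0"
    using False by auto
  moreover have "cubic_symbol ((l * x1 + m - b) * (l * x2 + m - b) * (l * x3 + m - b)) = 1"
    unfolding prod using False by (intro cubic_symbol_cube[OF card]) simp
  ultimately show ?thesis by (simp add: cubic_symbol_mult)
next
  case True
  have prod: "(l * x1 + m + b) * (l * x2 + m + b) * (l * x3 + m + b) = (m + b) ^ 3"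
    using v by Groebner_Basis.algebra
  have nz: "m + b \<noteq> 0" using True neg_b_neq by (simp add: add_eq_0_iff2)
  then have "l * x1 + m + b \<noteq> 0 \<and> l * x2 + m + b \<noteq> 0 \<and> l * x3 + m + b \<noteq> 0"
    using prod by auto
  then have "descent b (Point x1 (l * x1 + m)) = cubic_symbol (l * x1 + m + b) ^ 2"
    "descent b (Point x2 (l * x2 + m)) = cubic_symbol (l * x2 + m + b) ^ 2"
    "descent b (Point x3 (l * x3 + m)) = cubic_symbol (l * x3 + m + b) ^ 2"
    using P by (metis descent_plus add.left_inverse)+
  moreover have "cubic_symbol ((l * x1 + m + b) * (l * x2 + m + b) * (l * x3 + m + b)) = 1"
    unfolding prod using nz by (rule cubic_symbol_cube[OF card])
  ultimately show ?thesis
    by (simp add: cubic_symbol_mult flip: power_mult_distrib)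
qed

text \<open>The third point \<open>T\<close> on the line through \<open>P\<close> and
  \<open>R\<close> is the negative of their sum. Values at collinear points multiply to 1, so the
  sum has the inverse of the value at \<open>T\<close>.\<close>

lemma descent_padd:
  assumes "P \<in> curve (b ^ 2)" "R \<in> curve (b ^ 2)"
  shows "descent b (padd P R) = descent b P * descent b R"
proof (cases P)
  case P: (Point x1 y1)
  show ?thesis
  proof (cases R)
    case R: (Point x2 y2)
    show ?thesis
    proof (cases "x1 = x2 \<and> y1 = - y2")
      case True
      then have "P = pneg R" using P R by simp
      then have "descent b P * descent b R = descent b R ^ 3"
        using descent_pneg[OF assms(2)] by (simp add: power2_eq_square power3_eq_cube)
      then show ?thesis using True descent_pow3[of R] by (simp add: P R del: descent.simps(2))
    next
      case False
      obtain l m x3 where sum: "padd P R = Point x3 (- (l * x3 + m))"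
        and y: "y1 = l * x1 + m" "y2 = l * x2 + m"
        and v: "x1 + x2 + x3 = l ^ 2" "x1 * x2 + x1 * x3 + x2 * x3 = - 2 * l * m"
          "x1 * x2 * x3 = m ^ 2 - b ^ 2"
        using padd_line[OF two, of x1 y1 "b ^ 2" x2 y2] False assms unfolding P R by metis
      define T where "T = Point x3 (l * x3 + m)"
      have "padd P R \<in> curve (b ^ 2)" using assms by (rule padd_in_curve[OF two])
      moreover have T: "padd P R = pneg T" by (simp add: sum T_def)
      ultimately have "T \<in> curve (b ^ 2)" by simp
      then have "descent b P * descent b R * descent b T = 1"
        using descent_collinear[OF _ _ _ v] assms unfolding T_def P R y by blast
      moreover have "descent b (padd P R) = descent b T ^ 2"
        using \<open>T \<in> curve (b ^ 2)\<close> by (simp add: T descent_pneg)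
      ultimately show ?thesis using descent_pow3[of T] by Groebner_Basis.algebra
    qed
  qed (use assms P in simp)
qed simp

lemma descent_pmult:
  assumes "P \<in> curve (b ^ 2)"
  shows "descent b (pmult k P) = descent b P ^ k"
  using assms by (induction k) (auto simp: descent_padd pmult_in_curve two)


section \<open>The image of the isogeny\<close>

text \<open>The image ordinate \<open>Y\<close> satisfies \<open>Y - b = t ^ 3\<close> and
  \<open>Y + b = u ^ 3\<close> with \<open>t\<close>, \<open>u\<close> equal to
  \<open>(y - s * c) / x\<close> and \<open>(y + s * c) / x\<close>. The second identity settles
  \<open>Y = b\<close>, where \<open>descent\<close> reads the symbol of
  \<open>2 * b\<close>.\<close>

lemma descent_isog:
  assumes s: "s ^ 2 = - 3" and bc: "b = 3 * s * c" and P: "P \<in> curve (c ^ 2)"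
  shows "descent b (isog (c ^ 2) P) = 1"
proof (cases "P = Infinity \<or> xcoord P = 0")
  case True
  then show ?thesis by (cases P) auto
next
  case False
  then obtain x y where P': "P = Point x y" and x: "x \<noteq> 0"
    by (metis point.exhaust point.sel(1))
  define X where "X = (y ^ 2 + 3 * c ^ 2) / x ^ 2"
  define Y where "Y = y * (x ^ 3 - 8 * c ^ 2) / x ^ 3"
  have e: "y ^ 2 = x ^ 3 + c ^ 2" using P P' by simp
  have im: "isog (c ^ 2) P = Point X Y" using P' x by (simp add: X_def Y_def)
  define t where "t = (y - s * c) / x"
  define u where "u = (y + s * c) / x"
  have tx: "t * x = y - s * c" and ux: "u * x = y + s * c"
    using x by (simp_all add: t_def u_def)
  have Yx: "Y * x ^ 3 = y * (x ^ 3 - 8 * c ^ 2)" using x by (simp add: Y_def)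
  have "(y - s * c) ^ 3 = y * (x ^ 3 - 8 * c ^ 2) - 3 * s * c * x ^ 3"
    using s e by Groebner_Basis.algebra
  then have "x ^ 3 * (Y - b) = x ^ 3 * t ^ 3"
    unfolding tx[symmetric] Yx[symmetric] bc by Groebner_Basis.algebra
  then have t: "Y - b = t ^ 3" using x by simp
  have "(y + s * c) ^ 3 = y * (x ^ 3 - 8 * c ^ 2) + 3 * s * c * x ^ 3"
    using s e by Groebner_Basis.algebra
  then have "x ^ 3 * (Y + b) = x ^ 3 * u ^ 3"
    unfolding ux[symmetric] Yx[symmetric] bc by Groebner_Basis.algebra
  then have u: "Y + b = u ^ 3" using x by simp
  have "descent b (Point X Y) = 1"
  proof (cases "Y = b")
    case False
    then have "t \<noteq> 0" using t by auto
    then show ?thesis using False t cubic_symbol_cube[OF card] by simp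
  next
    case True
    then have "2 * b = u ^ 3" using u by simp
    moreover from this have "u \<noteq> 0" using two b by auto
    ultimately show ?thesis using True cubic_symbol_cube[OF card] by simp
  qed
  then show ?thesis using im by simp
qed

text \<open>The preimage comes from solving \<open>(y - s c) / x = t\<close>, \<open>(y + s c) / x = u\<close>, where \<open>t\<close>, \<open>u\<close>
  are the cube roots of \<open>Y - b\<close>, \<open>Y + b\<close> with \<open>t u = X\<close>.\<close>

lemma isog_preimage:
  assumes s: "s ^ 2 = - 3" and bc: "b = 3 * s * c"
    and R: "R \<in> curve (b ^ 2)" and h: "descent b R = 1"
  shows "R \<in> isog (c ^ 2) ` curve (c ^ 2)"
proof (cases R)
  case Infinity
  then show ?thesis by (intro image_eqI[of _ _ Infinity]) auto
next
  case R': (Point X Y)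
  have e: "Y ^ 2 = X ^ 3 + b ^ 2" using R R' by simp
  have "\<exists>t u. Y - b = t ^ 3 \<and> Y + b = u ^ 3 \<and> X = t * u"
  proof (cases "Y = b")
    case True
    then have "X = 0" using e by simp
    have "cubic_symbol (2 * b) ^ 2 = 1" using h R' True by simp
    moreover have "cubic_symbol (2 * b) ^ 3 = 1"
      using two b by (intro cubic_symbol_pow3[OF card]) simp
    ultimately have "cubic_symbol (2 * b) = 1" by Groebner_Basis.algebra
    then obtain u where "2 * b = u ^ 3"
      using cubic_symbol_eq_1_iff[OF card, of "2 * b"] two b by auto
    then show ?thesis using True \<open>X = 0\<close>
      by (intro exI[of _ 0] exI[of _ u]) simp
  next
    case False
    then have "cubic_symbol (Y - b) = 1" using h R' by simp
    then obtain t where t: "Y - b = t ^ 3"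
      using cubic_symbol_eq_1_iff[OF card, of "Y - b"] False by auto
    then have t0: "t \<noteq> 0" using False by auto
    have Xt: "X = t * (X / t)" using t0 by simp
    have "t ^ 3 * (Y + b) = t ^ 3 * (X / t) ^ 3"
      using e t Xt by Groebner_Basis.algebra
    then have "Y + b = (X / t) ^ 3" using t0 by simp
    then show ?thesis using t Xt by blast
  qed
  then obtain t u where t: "Y - b = t ^ 3" and u: "Y + b = u ^ 3" and X: "X = t * u" by blast
  have ut: "u - t \<noteq> 0"
  proof
    assume "u - t = 0"
    then have "2 * b = 0" using t u by Groebner_Basis.algebra
    then show False using two b by simp
  qed
  define x where "x = 2 * s * c / (u - t)"
  define y where "y = x * (u + t) / 2"
  have sc: "s * c \<noteq> 0" using bc b by auto
  have x0: "x \<noteq> 0" using sc two ut by (simp add: x_def)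
  have xut: "x * (u - t) = 2 * s * c" using ut by (simp add: x_def)
  have y2: "2 * y = x * (u + t)" using two by (simp add: y_def)
  have "2 * (x * t) = 2 * (y - s * c)" using xut y2 by Groebner_Basis.algebra
  then have tx: "x * t = y - s * c" using two mult_left_cancel by blast
  have "2 * (x * u) = 2 * (y + s * c)" using xut y2 by Groebner_Basis.algebra
  then have ux: "x * u = y + s * c" using two mult_left_cancel by blast
  have c6: "u ^ 3 - t ^ 3 = 6 * s * c" using t u bc by Groebner_Basis.algebra
  \<comment> \<open>Scaling \<open>u ^ 3 - t ^ 3 = (u - t) ^ 3 + 3 * t * u * (u - t)\<close> by
    \<open>x ^ 3\<close> gives \<open>6 s c x^3 = (2 s c)^3 + 6 s c (y^2 + 3 c^2)\<close>, which is
    the curve equation times \<open>6 s c\<close>.\<close>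
  have "(u - t) ^ 3 * y ^ 2 = (u - t) ^ 3 * (x ^ 3 + c ^ 2)"
    using tx ux xut c6 s by Groebner_Basis.algebra
  then have cur: "y ^ 2 = x ^ 3 + c ^ 2" using ut by simp
  have "x ^ 2 * X = y ^ 2 + 3 * c ^ 2" using X tx ux s by Groebner_Basis.algebra
  then have 1: "X = (y ^ 2 + 3 * c ^ 2) / x ^ 2" using x0 by (simp add: field_simps)
  have "x ^ 3 * Y = y * (x ^ 3 - 8 * c ^ 2)"
  proof -
    have "(y - s * c) ^ 3 = y * (x ^ 3 - 8 * c ^ 2) - 3 * s * c * x ^ 3"
      using s cur by Groebner_Basis.algebra
    moreover have "x ^ 3 * (Y - b) = (y - s * c) ^ 3"
      unfolding t tx[symmetric] by (simp add: power_mult_distrib)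
    ultimately show ?thesis unfolding bc by Groebner_Basis.algebra
  qed
  then have 2: "Y = y * (x ^ 3 - 8 * c ^ 2) / x ^ 3" using x0 by (simp add: field_simps)
  have "isog (c ^ 2) (Point x y) = R" using x0 R' 1 2 by simp
  then show ?thesis using cur by (intro image_eqI[of _ _ "Point x y"]) auto
qed

lemma isog_image_iff:
  assumes "s ^ 2 = - 3" "b = 3 * s * c" "R \<in> curve (b ^ 2)"
  shows "R \<in> isog (c ^ 2) ` curve (c ^ 2) \<longleftrightarrow> descent b R = 1"
  using isog_preimage[OF assms] descent_isog[OF assms(1,2)] by blast

text \<open>Subtracting \<open>j\<close> copies of \<open>Q\<close> divides the descent value by
  \<open>g ^ j\<close>, where \<open>g\<close> is the value at \<open>Q\<close>. As \<open>g\<close>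
  has order 3, exactly one \<open>j\<close> in \<open>{0, 1, 2}\<close> lands in the kernel.\<close>

lemma isog_char_eq:
  assumes s: "s ^ 2 = - 3" "b = 3 * s * c"
    and Q: "Q \<in> curve (b ^ 2)" "descent b Q \<noteq> 1" and P: "P \<in> curve (b ^ 2)"
    and k: "k \<in> {0, 1, 2}" "descent b P = descent b Q ^ k"
  shows "isog_char (c ^ 2) Q \<zeta> P = \<zeta> ^ k"
proof -
  define g where "g = descent b Q"
  have g3: "g ^ 3 = 1" by (simp add: g_def descent_pow3)
  have iff: "padd P (pneg (pmult j Q)) \<in> isog (c ^ 2) ` curve (c ^ 2) \<longleftrightarrow> g ^ k = g ^ j" for j
  proof -
    have j: "pmult j Q \<in> curve (b ^ 2)" using Q(1) by (rule pmult_in_curve[OF two])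
    then have "padd P (pneg (pmult j Q)) \<in> curve (b ^ 2)"
      using P by (simp add: padd_in_curve two)
    moreover have "descent b (padd P (pneg (pmult j Q))) = g ^ k * (g ^ j) ^ 2"
      using descent_padd[OF P] descent_pneg[OF j] descent_pmult[OF Q(1)] j
      unfolding k(2) g_def by simp
    ultimately have "padd P (pneg (pmult j Q)) \<in> isog (c ^ 2) ` curve (c ^ 2) \<longleftrightarrow>
        g ^ k * (g ^ j) ^ 2 = 1"
      by (simp only: isog_image_iff[OF s])
    moreover have "(g ^ j) ^ 3 = 1"
      by (simp only: power_mult[symmetric] mult.commute[of j 3]) (simp add: power_mult g3)
    ultimately show ?thesis by (simp only: mult_square_eq_1_iff)
  qed
  have g1: "g \<noteq> 1" using Q(2) by (simp add: g_def)
  note g2 = square_neq_if_cube_eq_1[OF g3 g1]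
  have eq: "j = k" if "j \<in> {0, 1, 2}" "g ^ k = g ^ j" for j
  proof -
    have "j = 0 \<or> j = 1 \<or> j = 2" "k = 0 \<or> k = 1 \<or> k = 2" using that k(1) by auto
    then show ?thesis using that(2) g1 g2 by (elim disjE) simp_all
  qed
  have "(THE j. j \<in> {0, 1, 2} \<and> padd P (pneg (pmult j Q)) \<in> isog (c ^ 2) ` curve (c ^ 2)) = k"
    unfolding iff
  proof (rule the_equality)
    show "k \<in> {0, 1, 2} \<and> g ^ k = g ^ k" using k(1) by (rule conjI) (rule refl)
    show "j = k" if "j \<in> {0, 1, 2} \<and> g ^ k = g ^ j" for j
      using that by (elim conjE) (rule eq)
  qed
  then show ?thesis by (simp only: isog_char_def)
qed

text \<open>A nontrivial cube root of unity generates all of them, so the three classes exhaust the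
  curve.\<close>

lemma descent_cases:
  assumes "descent b Q \<noteq> 1"
  obtains k where "k \<in> {0, 1, 2}" "descent b P = descent b Q ^ k"
proof -
  define g where "g = descent b Q"
  have "(g - 1) * (g ^ 2 + g + 1) = 0" using descent_pow3[of Q] unfolding g_def by Groebner_Basis.algebra
  then have g: "g ^ 2 + g + 1 = 0" using assms by (simp add: g_def)
  have "descent b P ^ 3 = 1 ^ 3" by (simp add: descent_pow3)
  from cube_eq_cube_cases[OF g this]
  have "descent b P = g ^ 0 \<or> descent b P = g ^ 1 \<or> descent b P = g ^ 2" by simp
  then show ?thesis using that unfolding g_def by blast
qed

end


section \<open>Class sums of abscissae\<close>

text \<open>Scaling abscissae by \<open>w\<close> permutes \<open>S\<close>, so the sum equals
  \<open>w\<close> times itself. \<open>Infinity\<close> is excluded because \<open>xcoord\<close>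
  is unspecified there.\<close>

lemma sum_xcoord_eq_0:
  fixes w :: "'a::field"
  assumes "w ^ 3 = 1" "w \<noteq> 1" and fin: "finite S" and "Infinity \<notin> S"
    and stable: "\<And>x y. Point x y \<in> S \<Longrightarrow> Point (w * x) y \<in> S"
  shows "(\<Sum>P\<in>S. xcoord P) = 0"
proof -
  define r where "r P = Point (w * xcoord P) (ycoord P)" for P
  have w0: "w \<noteq> 0" using assms(1) by auto
  have eq: "P = Point (xcoord P) (ycoord P)" if "P \<in> S" for P
    using that assms(4) by (cases P) auto
  have inj: "inj_on r S"
    by (rule inj_onI) (metis eq r_def point.inject w0 mult_left_cancel)
  have "r ` S \<subseteq> S" using stable eq unfolding r_def by fastforce
  then have im: "r ` S = S" using inj fin by (intro endo_inj_surj) auto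
  have "(\<Sum>P\<in>S. xcoord P) = (\<Sum>P\<in>r ` S. xcoord P)" by (simp add: im)
  also have "\<dots> = (\<Sum>P\<in>S. w * xcoord P)"
    by (subst sum.reindex[OF inj]) (simp add: r_def)
  finally have "(w - 1) * (\<Sum>P\<in>S. xcoord P) = 0"
    by (simp add: sum_distrib_left[symmetric] algebra_simps)
  then show ?thesis using assms(2) by simp
qed

text \<open>Reducing the sum of representatives modulo the characteristic recovers the sum in the
  field.\<close>

lemma dvd_sum_to_int_mod_ring:
  fixes f :: "'b \<Rightarrow> 'p::prime_card mod_ring"
  assumes "(\<Sum>x\<in>S. f x) = 0"
  shows "int CARD('p) dvd (\<Sum>x\<in>S. to_int_mod_ring (f x))"
proof -
  have "(of_int (\<Sum>x\<in>S. to_int_mod_ring (f x)) :: 'p mod_ring) = 0"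
    using assms unfolding of_int_sum by (simp add: of_int_of_int_mod_ring)
  then show ?thesis unfolding of_int_eq_0_iff_char_dvd by simp
qed

theorem theorem1:
  fixes p :: nat
    and d d' :: "'p::prime_card mod_ring"
    and Q :: "'p mod_ring point"
    and \<zeta> :: complex
  assumes "p = CARD('p)"
    and "[p = 1] (mod 3)"
    and "d \<noteq> 0"
    and "\<exists>c. d = c ^ 2"
    and "d' = - 27 * d"
    and "primitive_root_of_unity 3 \<zeta>"
    and "Q \<in> curve d' - isog d ` curve d"
  shows "\<exists>m::int. (\<Sum>P \<in> curve d' - {Infinity}.
            of_int (to_int_mod_ring (xcoord P)) * isog_char d Q \<zeta> P) = (of_int m :: complex)
          \<and> int p dvd m"
proof -
  have p: "p mod 3 = 1" using assms(2) by (simp add: cong_def)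
  have card: "CARD('p mod_ring) mod 3 = 1" using p assms(1) by simp
  have p4: "p \<ge> 4" using card_ge_4[OF card] assms(1) by simp
  have two: "(2::'p mod_ring) \<noteq> 0"
  proof
    assume "(2::'p mod_ring) = 0"
    then have "p dvd 2" using of_nat_0_mod_ring_dvd[of 2] assms(1) by simp
    then show False using p4 by (auto dest: dvd_imp_le)
  qed
  obtain w :: "'p mod_ring" where w: "w ^ 2 + w + 1 = 0" and w1: "w \<noteq> 1"
    using primitive_cube_root_exists[OF card] by blast
  have w3: "w ^ 3 = 1" using w by Groebner_Basis.algebra
  \<comment> \<open>In characteristic 3, \<open>X^2 + X + 1\<close> is \<open>(X - 1)^2\<close>,
    whose only root is 1.\<close>
  have three: "(3::'p mod_ring) \<noteq> 0"
  proof
    assume "(3::'p mod_ring) = 0"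
    moreover have "(w - 1) ^ 2 = (w ^ 2 + w + 1) - 3 * w" by Groebner_Basis.algebra
    ultimately have "(w - 1) ^ 2 = 0" using w by simp
    then show False using w1 by simp
  qed
  \<comment> \<open>Completing the square in \<open>w ^ 2 + w + 1 = 0\<close> yields a square root
    of \<open>-3\<close>.\<close>
  define s where "s = 2 * w + 1"
  have s: "s ^ 2 = - 3" unfolding s_def using w by Groebner_Basis.algebra
  obtain c where c: "d = c ^ 2" using assms(4) by blast
  define b where bc: "b = 3 * s * c"
  have d': "d' = b ^ 2" unfolding assms(5) c bc using s by Groebner_Basis.algebra
  have "s \<noteq> 0" using s three by auto
  then have b0: "b \<noteq> 0" using c assms(3) three by (auto simp: bc)
  interpret three_descent b using card two b0 by unfold_locales
  have Q: "Q \<in> curve (b ^ 2)" using assms(7) d' by simp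
  have hQ: "descent b Q \<noteq> 1"
    using isog_preimage[OF s bc Q] assms(7) c by auto

  \<comment> \<open>Classes are cut out by \<open>descent\<close> rather than by
    \<open>isog_char\<close>, which makes their behaviour under \<open>w\<close> and negation
    visible; \<open>char\<close> translates back.\<close>
  define cls where "cls k = {P \<in> curve (b ^ 2) - {Infinity}. descent b P = descent b Q ^ k}" for k
  define N where "N k = (\<Sum>P\<in>cls k. to_int_mod_ring (xcoord P))" for k
  have dvd: "int p dvd N k" for k
  proof -
    have "(\<Sum>P\<in>cls k. xcoord P) = 0"
      using w3 w1 by (intro sum_xcoord_eq_0[of w])
        (auto simp: cls_def finite_point_set power_mult_distrib)
    then show ?thesis unfolding N_def assms(1) by (rule dvd_sum_to_int_mod_ring)
  qed
  have char: "isog_char d Q \<zeta> P = \<zeta> ^ k" if "P \<in> cls k" "k \<in> {0, 1, 2}" for P k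
    using that isog_char_eq[OF s bc Q hQ] unfolding cls_def c by blast

  define g where "g = descent b Q"
  have g3: "g ^ 3 = 1" by (simp add: g_def descent_pow3)
  have g1: "g \<noteq> 1" using hQ by (simp add: g_def)
  note g2 = square_neq_if_cube_eq_1[OF g3 g1]
  have N12: "N 1 = N 2"
    unfolding N_def
  proof (rule sum.reindex_bij_witness[of _ pneg pneg])
    fix P
    \<comment> \<open>Negation squares descent values, so it swaps \<open>g\<close> and
      \<open>g ^ 2\<close>.\<close>
    have g4: "(g ^ 2) ^ 2 = g" using g3 by Groebner_Basis.algebra
    show "pneg P \<in> cls 2" if "P \<in> cls 1"
      using that by (auto simp: cls_def descent_pneg)
    show "pneg P \<in> cls 1" if "P \<in> cls 2"
      using that g4 by (simp add: cls_def descent_pneg flip: g_def)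
    show "to_int_mod_ring (xcoord (pneg P)) = to_int_mod_ring (xcoord P)" if "P \<in> cls 1"
      using that by (auto simp: cls_def xcoord_pneg)
  qed auto

  have \<zeta>: "1 + \<zeta> + \<zeta> ^ 2 = 0"
  proof -
    have "\<zeta> ^ 3 = 1" "\<zeta> \<noteq> 1"
      using assms(6) by (auto simp: primitive_root_of_unity_def dest: spec[of _ 1])
    then have "(\<zeta> - 1) * (1 + \<zeta> + \<zeta> ^ 2) = 0" by Groebner_Basis.algebra
    then show ?thesis using \<open>\<zeta> \<noteq> 1\<close> by simp
  qed

  have part: "curve d' - {Infinity} = (\<Union>k\<in>{0, 1, 2}. cls k)"
    using descent_cases[OF hQ] unfolding d' cls_def by blast
  have disj: "cls j \<inter> cls k = {}" if "j \<in> {0, 1, 2}" "k \<in> {0, 1, 2}" "j \<noteq> k" for j k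
    using that g1 g2 unfolding cls_def g_def[symmetric] by auto
  let ?f = "\<lambda>P. of_int (to_int_mod_ring (xcoord P)) * isog_char d Q \<zeta> P"
  have "(\<Sum>P \<in> curve d' - {Infinity}. ?f P) = (\<Sum>k\<in>{0, 1, 2}. \<Sum>P\<in>cls k. ?f P)"
    unfolding part using disj by (intro sum.UNION_disjoint) (auto simp: finite_point_set)
  also have "\<dots> = (\<Sum>k\<in>{0, 1, 2}. of_int (N k) * \<zeta> ^ k)"
    using char by (intro sum.cong) (auto simp: N_def sum_distrib_right)
  also have "\<dots> = of_int (N 0) + of_int (N 2) * \<zeta> + of_int (N 2) * \<zeta> ^ 2"
    using N12 by (simp add: add.assoc)
  \<comment> \<open>Here \<open>\<zeta> + \<zeta> ^ 2 = -1\<close>, which makes the sum an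
    integer.\<close>
  also have "\<dots> = of_int (N 0 - N 2)"
    unfolding of_int_diff using \<zeta> by Groebner_Basis.algebra
  finally show ?thesis using dvd by (intro exI[of _ "N 0 - N 2"]) auto
qed

end
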